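(* Let $G_0=\mathbb{I}\oplus\mathbb{I}\ell$ be the icosian double, let $C\subset(\mathbb{Z}[\varphi]/2)^8\cong\mathbb{F}_4^8$ be an $\mathbb{F}_4$-linear subspace, and put $$G_C=G_0+\tfrac12 C.$$ Under the strict $\mathbb{Z}[\varphi]$-order convention requiring integral pairings with the baseline basis of $G_0$ (that is, $B(x,g)\in\mathbb{Z}[\varphi]$ for $x\in G_C$ and $g$ in the basis $e_1,\dots,e_4,e_1\ell,\dots,e_4\ell$ of $G_0$), no nonzero $C$ gives a G3 candidate $G_C$.
   Context: Let $\varphi=(1+\sqrt5)/2$, $K=\mathbb{Q}(\sqrt5)$. $\mathbb{H}(K)$ is the quaternion algebra over $K$ with basis $1,i,j,k$, $i^2=j^2=k^2=ijk=-1$, with standard conjugation. The icosian ring $\mathbb{I}\subset\mathbb{H}(K)$ is the free $\mathbb{Z}[\varphi]$-module with basis $$e_1=1,\quad e_2=i,\quad e_3=\tfrac12(1+i+j+k),\quad e_4=\tfrac12(-1+(\varphi-1)i-\varphi j).$$ $\mathbb{O}(K)=\mathbb{H}(K)\oplus\mathbb{H}(K)\ell$ is the Cayley--Dickson double with product $(a+b\ell)(c+d\ell)=(ac-\overline{d}b)+(da+b\overline{c})\ell$, conjugation $\overline{a+b\ell}=\overline{a}-b\ell$, and norm $N(x)=x\overline{x}$. The polar form of the norm is $B(x,y)=N(x+y)-N(x)-N(y)$. Here $\mathbb{Z}[\varphi]/2\mathbb{Z}[\varphi]\cong\mathbb{F}_4$; via the basis of $G_0$, $(\mathbb{Z}[\varphi]/2)^8$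 is identified with $G_0/2G_0\cong(\tfrac12G_0)/G_0$, and $G_0+\tfrac12C$ denotes the set of all $v/2$ with $v\in G_0$ and $v \bmod 2G_0\in C$. A G3 candidate is a denominator-two enlargement of $G_0$ of this kind proposed as a stronger golden octonion order (an analogue of the Coxeter--Dickson octonion order over $\mathbb{Z}[\varphi]$), and required to pass the following tests: mixed coset (the adjoined cosets do not all lie in one of the two halves $\mathbb{I}$, $\mathbb{I}\ell$), stability under conjugation, integral pairing ($B$ of adjoined elements with the basis of $G_0$ lies in $\mathbb{Z}[\varphi]$), integral norm ($N$ takes values in $\mathbb{Z}[\varphi]$), closure under multiplication, and closure under squares. *)

theory Defs
  imports "HOL-Analysis.Analysis"
begin

text \<open>\<open>K = \<rat>(\<surd>5)\<close>, realised as a subfield of the reals.\<close>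
typedef qsqrt5 = "{x :: real. \<exists>a b. a \<in> \<rat> \<and> b \<in> \<rat> \<and> x = a + b * sqrt 5}"
  by (auto intro!: exI[of _ 0])

setup_lifting type_definition_qsqrt5

lemma sqrt5_mult_sqrt5: "sqrt 5 * (sqrt 5 * x) = 5 * x"
  by (simp flip: mult.assoc)

lemma sqrt5_irrational: "sqrt 5 \<notin> \<rat>"
proof
  assume "sqrt 5 \<in> \<rat>"
  then obtain m n where n: "n \<noteq> 0" and mn: "\<bar>sqrt 5\<bar> = real m / real n" "coprime m n"
    by (rule Rats_abs_nat_div_natE)
  have "real m = sqrt 5 * real n" using mn n by (simp add: field_simps)
  then have "real (m\<^sup>2) = real (5 * n\<^sup>2)" by (simp add: power_mult_distrib)
  then have eq: "m\<^sup>2 = 5 * n\<^sup>2" by linarith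
  have p: "prime (5::nat)" by simp
  have "5 dvd m\<^sup>2" using eq by simp
  then have d: "5 dvd m" using p prime_dvd_power by blast
  then obtain k where "m = 5 * k" by blast
  then have "n\<^sup>2 = 5 * k\<^sup>2" using eq by (simp add: power2_eq_square)
  then have "5 dvd n" using p prime_dvd_power by (metis dvd_triv_left)
  then show False using d mn(2) coprime_common_divisor_nat by fastforce
qed

instantiation qsqrt5 :: field
begin

lift_definition zero_qsqrt5 :: qsqrt5 is 0 by (auto intro!: exI[of _ 0])
lift_definition one_qsqrt5 :: qsqrt5 is 1
  by (rule exI[of _ 1], rule exI[of _ 0]) auto
lift_definition plus_qsqrt5 :: "qsqrt5 \<Rightarrow> qsqrt5 \<Rightarrow> qsqrt5" is "(+)"
proof -
  fix x y :: real
  assume "\<exists>a b. a \<in> \<rat> \<and> b \<in> \<rat> \<and> x = a + b * sqrt 5" "\<exists>a b. a \<in> \<rat> \<and> b \<in> \<rat> \<and> y = a + b * sqrt 5"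
  then obtain a b c d where "a \<in> \<rat>" "b \<in> \<rat>" "c \<in> \<rat>" "d \<in> \<rat>" "x = a + b * sqrt 5" "y = c + d * sqrt 5"
    by blast
  then show "\<exists>a b. a \<in> \<rat> \<and> b \<in> \<rat> \<and> x + y = a + b * sqrt 5"
    by (intro exI[of _ "a + c"] exI[of _ "b + d"]) (simp add: algebra_simps)
qed
lift_definition uminus_qsqrt5 :: "qsqrt5 \<Rightarrow> qsqrt5" is uminus
proof -
  fix x :: real
  assume "\<exists>a b. a \<in> \<rat> \<and> b \<in> \<rat> \<and> x = a + b * sqrt 5"
  then obtain a b where "a \<in> \<rat>" "b \<in> \<rat>" "x = a + b * sqrt 5" by blast
  then show "\<exists>a b. a \<in> \<rat> \<and> b \<in> \<rat> \<and> - x = a + b * sqrt 5"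
    by (intro exI[of _ "- a"] exI[of _ "- b"]) simp
qed
lift_definition minus_qsqrt5 :: "qsqrt5 \<Rightarrow> qsqrt5 \<Rightarrow> qsqrt5" is "(-)"
proof -
  fix x y :: real
  assume "\<exists>a b. a \<in> \<rat> \<and> b \<in> \<rat> \<and> x = a + b * sqrt 5" "\<exists>a b. a \<in> \<rat> \<and> b \<in> \<rat> \<and> y = a + b * sqrt 5"
  then obtain a b c d where "a \<in> \<rat>" "b \<in> \<rat>" "c \<in> \<rat>" "d \<in> \<rat>" "x = a + b * sqrt 5" "y = c + d * sqrt 5"
    by blast
  then show "\<exists>a b. a \<in> \<rat> \<and> b \<in> \<rat> \<and> x - y = a + b * sqrt 5"
    by (intro exI[of _ "a - c"] exI[of _ "b - d"]) (simp add: algebra_simps)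
qed
lift_definition times_qsqrt5 :: "qsqrt5 \<Rightarrow> qsqrt5 \<Rightarrow> qsqrt5" is "(*)"
proof -
  fix x y :: real
  assume "\<exists>a b. a \<in> \<rat> \<and> b \<in> \<rat> \<and> x = a + b * sqrt 5" "\<exists>a b. a \<in> \<rat> \<and> b \<in> \<rat> \<and> y = a + b * sqrt 5"
  then obtain a b c d where "a \<in> \<rat>" "b \<in> \<rat>" "c \<in> \<rat>" "d \<in> \<rat>" "x = a + b * sqrt 5" "y = c + d * sqrt 5"
    by blast
  then show "\<exists>a b. a \<in> \<rat> \<and> b \<in> \<rat> \<and> x * y = a + b * sqrt 5"
    by (intro exI[of _ "a * c + 5 * b * d"] exI[of _ "a * d + b * c"])
       (simp add: algebra_simps sqrt5_mult_sqrt5)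
qed
lift_definition inverse_qsqrt5 :: "qsqrt5 \<Rightarrow> qsqrt5" is inverse
proof -
  fix x :: real
  assume "\<exists>a b. a \<in> \<rat> \<and> b \<in> \<rat> \<and> x = a + b * sqrt 5"
  then obtain a b where ab: "a \<in> \<rat>" "b \<in> \<rat>" "x = a + b * sqrt 5" by blast
  show "\<exists>a b. a \<in> \<rat> \<and> b \<in> \<rat> \<and> inverse x = a + b * sqrt 5"
  proof (cases "a - b * sqrt 5 = 0")
    case True
    have "b = 0"
    proof (rule ccontr)
      assume "b \<noteq> 0"
      then have "sqrt 5 = a / b" using True by (simp add: field_simps)
      then show False using sqrt5_irrational ab by simp
    qed
    then show ?thesis using ab by (intro exI[of _ "inverse a"] exI[of _ 0]) simp
  next
    case False
    define n where "n = a\<^sup>2 - 5 * b\<^sup>2"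
    have n: "n = x * (a - b * sqrt 5)"
      by (simp add: n_def ab algebra_simps power2_eq_square sqrt5_mult_sqrt5)
    have "inverse x = (a - b * sqrt 5) / n"
      using False unfolding n by (cases "x = 0") (simp_all add: divide_inverse)
    moreover have "n \<in> \<rat>" using ab by (simp add: n_def)
    ultimately show ?thesis using ab
      by (intro exI[of _ "a / n"] exI[of _ "- b / n"]) (simp add: diff_divide_distrib)
  qed
qed
definition divide_qsqrt5 :: "qsqrt5 \<Rightarrow> qsqrt5 \<Rightarrow> qsqrt5" where
  "divide_qsqrt5 x y = x * inverse y"

instance
  by standard (transfer; simp add: algebra_simps divide_qsqrt5_def)+

end

lemma Rep_qsqrt5_of_nat: "Rep_qsqrt5 (of_nat n) = of_nat n"
  by (induction n) (simp_all add: plus_qsqrt5.rep_eq one_qsqrt5.rep_eq zero_qsqrt5.rep_eq)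

instance qsqrt5 :: field_char_0
  by standard (metis Rep_qsqrt5_of_nat injI of_nat_eq_iff)

lift_definition golden :: qsqrt5 (\<open>\<phi>\<close>) is "(1 + sqrt 5) / 2"
  by (intro exI[of _ "1/2"]) (simp add: add_divide_distrib)

lemma golden_squared: "\<phi> * \<phi> = \<phi> + 1"
  by transfer (simp add: field_simps)

definition Zphi :: "qsqrt5 set" (\<open>\<int>[\<phi>]\<close>) where
  "\<int>[\<phi>] = {of_int a + of_int b * \<phi> | a b. True}"

lemma Zphi_zero: "0 \<in> \<int>[\<phi>]"
  unfolding Zphi_def by (rule CollectI, rule exI[of _ 0], rule exI[of _ 0]) simp

lemma Zphi_one: "1 \<in> \<int>[\<phi>]"
  unfolding Zphi_def by (rule CollectI, rule exI[of _ 1], rule exI[of _ 0]) simp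

lemma Zphi_add: "x \<in> \<int>[\<phi>] \<Longrightarrow> y \<in> \<int>[\<phi>] \<Longrightarrow> x + y \<in> \<int>[\<phi>]"
  unfolding Zphi_def
proof clarify
  fix a b c d
  show "\<exists>a' b'. of_int a + of_int b * \<phi> + (of_int c + of_int d * \<phi>) = of_int a' + of_int b' * \<phi> \<and> True"
    by (rule exI[of _ "a + c"], rule exI[of _ "b + d"]) (simp add: algebra_simps)
qed

lemma Zphi_minus: "x \<in> \<int>[\<phi>] \<Longrightarrow> - x \<in> \<int>[\<phi>]"
  unfolding Zphi_def
proof clarify
  fix a b
  show "\<exists>a' b'. - (of_int a + of_int b * \<phi>) = of_int a' + of_int b' * \<phi> \<and> True"
    by (rule exI[of _ "- a"], rule exI[of _ "- b"]) simp
qed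

lemma Zphi_diff: "x \<in> \<int>[\<phi>] \<Longrightarrow> y \<in> \<int>[\<phi>] \<Longrightarrow> x - y \<in> \<int>[\<phi>]"
  using Zphi_add[of x "- y"] Zphi_minus by simp

lemma Zphi_mult_eq:
  "(of_int a + of_int b * \<phi>) * (of_int c + of_int d * \<phi>) =
    of_int (a * c + b * d) + of_int (a * d + b * c + b * d) * \<phi>"
proof -
  have "(of_int a + of_int b * \<phi>) * (of_int c + of_int d * \<phi>) =
      of_int a * of_int c + (of_int a * of_int d + of_int b * of_int c) * \<phi> + of_int b * of_int d * (\<phi> * \<phi>)"
    by (simp add: algebra_simps)
  then show ?thesis unfolding golden_squared by (simp add: algebra_simps)
qed

lemma Zphi_mult: "x \<in> \<int>[\<phi>] \<Longrightarrow> y \<in> \<int>[\<phi>] \<Longrightarrow> x * y \<in> \<int>[\<phi>]"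
  unfolding Zphi_def using Zphi_mult_eq by blast

lemma Zphi_eq_iff:
  "(of_int a + of_int b * \<phi> = of_int c + of_int d * \<phi>) \<longleftrightarrow> a = c \<and> b = d"
proof
  assume eq: "of_int a + of_int b * \<phi> = of_int c + of_int d * \<phi>"
  have rep: "Rep_qsqrt5 (of_int k) = of_int k" for k
    by (cases k rule: int_cases2)
       (simp_all add: Rep_qsqrt5_of_nat uminus_qsqrt5.rep_eq)
  have "of_int a + of_int b * ((1 + sqrt 5) / 2) = (of_int c + of_int d * ((1 + sqrt 5) / 2) :: real)"
    using arg_cong[OF eq, of Rep_qsqrt5]
    by (simp add: plus_qsqrt5.rep_eq times_qsqrt5.rep_eq golden.rep_eq rep)
  then have *: "(of_int b - of_int d) * sqrt 5 = 2 * (of_int c - of_int a) - (of_int b - of_int d :: real)"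
    by (simp add: field_simps)
  have "b = d"
  proof (rule ccontr)
    assume "b \<noteq> d"
    then have "sqrt 5 = (2 * (of_int c - of_int a) - (of_int b - of_int d)) / (of_int b - of_int d)"
      using * by (simp add: eq_divide_eq mult.commute)
    moreover have "(2 * (of_int c - of_int a) - (of_int b - of_int d)) / (of_int b - of_int d) \<in> (\<rat> :: real set)"
      by simp
    ultimately show False using sqrt5_irrational by simp
  qed
  then show "a = c \<and> b = d" using * by simp
qed simp

definition cong2 :: "qsqrt5 \<Rightarrow> qsqrt5 \<Rightarrow> bool" where
  "cong2 x y \<longleftrightarrow> x \<in> \<int>[\<phi>] \<and> y \<in> \<int>[\<phi>] \<and> (\<exists>z \<in> \<int>[\<phi>]. x - y = 2 * z)"

lemma cong2_refl: "x \<in> \<int>[\<phi>] \<Longrightarrow> cong2 x x"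
  unfolding cong2_def using Zphi_zero by (auto intro!: bexI[of _ 0])

lemma cong2_eqI: "x \<in> \<int>[\<phi>] \<Longrightarrow> x = y \<Longrightarrow> cong2 x y"
  using cong2_refl by blast

lemma cong2_left: "cong2 x y \<Longrightarrow> x \<in> \<int>[\<phi>]"
  by (simp add: cong2_def)

lemma cong2_sym: "cong2 x y \<Longrightarrow> cong2 y x"
  unfolding cong2_def by (metis Zphi_minus minus_diff_eq mult_minus_right)

lemma cong2_trans: "cong2 x y \<Longrightarrow> cong2 y z \<Longrightarrow> cong2 x z"
  unfolding cong2_def
  by (metis Zphi_add diff_add_cancel add_diff_eq distrib_left)

lemma cong2_add: "cong2 x x' \<Longrightarrow> cong2 y y' \<Longrightarrow> cong2 (x + y) (x' + y')"
  unfolding cong2_def by (metis Zphi_add add_diff_add distrib_left)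

lemma cong2_minus: "cong2 x y \<Longrightarrow> cong2 (- x) (- y)"
  unfolding cong2_def by (metis Zphi_minus minus_diff_minus mult_minus_right)

lemma cong2_diff: "cong2 x x' \<Longrightarrow> cong2 y y' \<Longrightarrow> cong2 (x - y) (x' - y')"
  using cong2_add[of x x' "- y" "- y'"] cong2_minus by simp

lemma cong2_mult:
  assumes "cong2 x x'" "cong2 y y'"
  shows "cong2 (x * y) (x' * y')"
proof -
  obtain z w where z: "z \<in> \<int>[\<phi>]" "x - x' = 2 * z" and w: "w \<in> \<int>[\<phi>]" "y - y' = 2 * w"
    using assms unfolding cong2_def by blast
  have "x * y - x' * y' = (x - x') * y + x' * (y - y')"
    by (simp add: algebra_simps)
  also have "\<dots> = 2 * (z * y + x' * w)"
    unfolding z w by (simp add: algebra_simps)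
  finally have "x * y - x' * y' = 2 * (z * y + x' * w)" .
  moreover have "z * y + x' * w \<in> \<int>[\<phi>]"
    using assms z w unfolding cong2_def by (intro Zphi_add Zphi_mult) auto
  ultimately show ?thesis
    using assms unfolding cong2_def by (blast intro: Zphi_mult)
qed

lemma cong2_iff:
  "cong2 (of_int a + of_int b * \<phi>) (of_int c + of_int d * \<phi>) \<longleftrightarrow> even (a - c) \<and> even (b - d)"
proof
  assume "cong2 (of_int a + of_int b * \<phi>) (of_int c + of_int d * \<phi>)"
  then obtain m n where
    "of_int a + of_int b * \<phi> - (of_int c + of_int d * \<phi>) = 2 * (of_int m + of_int n * \<phi>)"
    unfolding cong2_def Zphi_def by blast
  then have "of_int (a - c) + of_int (b - d) * \<phi> = of_int (2 * m) + of_int (2 * n) * \<phi>"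
    by (simp add: algebra_simps)
  then have "a - c = 2 * m \<and> b - d = 2 * n" by (simp only: Zphi_eq_iff)
  then show "even (a - c) \<and> even (b - d)" by simp
next
  assume "even (a - c) \<and> even (b - d)"
  then obtain m n where mn: "a - c = 2 * m" "b - d = 2 * n" unfolding dvd_def by blast
  have "of_int a + of_int b * \<phi> - (of_int c + of_int d * \<phi>) = of_int (a - c) + of_int (b - d) * \<phi>"
    by (simp add: algebra_simps)
  also have "\<dots> = 2 * (of_int m + of_int n * \<phi>)" unfolding mn by (simp add: algebra_simps)
  finally show "cong2 (of_int a + of_int b * \<phi>) (of_int c + of_int d * \<phi>)"
    unfolding cong2_def Zphi_def by blast
qed

lemma cong2_cube:
  assumes "x \<in> \<int>[\<phi>]" "\<not> cong2 x 0"
  shows "cong2 (x * x * x) 1"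
proof -
  obtain a b where x: "x = of_int a + of_int b * \<phi>" using assms(1) unfolding Zphi_def by blast
  have "\<not> (even a \<and> even b)" using assms(2) cong2_iff[of a b 0 0] x by simp
  then show ?thesis
    unfolding x Zphi_mult_eq
    using cong2_iff[of _ _ 1 0]
    by (simp only: of_int_1 of_int_0 mult_zero_left add_0_right) auto
qed

text \<open>\<open>\<int>[\<phi>]/2\<close>, the field with four elements: the equivalence \<open>cong2\<close> is partial, with domain \<open>\<int>[\<phi>]\<close>,
  and \<open>red2\<close> is the reduction map (meaningless outside \<open>\<int>[\<phi>]\<close>).\<close>
quotient_type zphi2 = qsqrt5 / partial: cong2
  morphisms rep_zphi2 red2
proof (rule part_equivpI)
  show "\<exists>x. cong2 x x" using cong2_refl Zphi_zero by blast
  show "symp cong2" using cong2_sym by (rule sympI)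
  show "transp cong2" using cong2_trans by (rule transpI)
qed

instantiation zphi2 :: field
begin

lift_definition zero_zphi2 :: zphi2 is 0 by (rule cong2_refl[OF Zphi_zero])
lift_definition one_zphi2 :: zphi2 is 1 by (rule cong2_refl[OF Zphi_one])
lift_definition plus_zphi2 :: "zphi2 \<Rightarrow> zphi2 \<Rightarrow> zphi2" is "(+)" by (rule cong2_add)
lift_definition uminus_zphi2 :: "zphi2 \<Rightarrow> zphi2" is uminus by (rule cong2_minus)
lift_definition minus_zphi2 :: "zphi2 \<Rightarrow> zphi2 \<Rightarrow> zphi2" is "(-)" by (rule cong2_diff)
lift_definition times_zphi2 :: "zphi2 \<Rightarrow> zphi2 \<Rightarrow> zphi2" is "(*)" by (rule cong2_mult)

text \<open>Nonzero elements of a field with four elements satisfy \<open>x\<^sup>3 = 1\<close>.\<close>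
definition inverse_zphi2 :: "zphi2 \<Rightarrow> zphi2" where "inverse_zphi2 x = x * x"
definition divide_zphi2 :: "zphi2 \<Rightarrow> zphi2 \<Rightarrow> zphi2" where "divide_zphi2 x y = x * inverse y"

instance
proof
  fix a b c :: zphi2
  show "a * b * c = a * (b * c)"
    by transfer (intro cong2_eqI Zphi_mult; simp add: cong2_left mult.assoc)
  show "a * b = b * a"
    by transfer (intro cong2_eqI Zphi_mult; simp add: cong2_left mult.commute)
  show "1 * a = a" by transfer simp
  show "a + b + c = a + (b + c)"
    by transfer (intro cong2_eqI Zphi_add; simp add: cong2_left add.assoc)
  show "a + b = b + a"
    by transfer (intro cong2_eqI Zphi_add; simp add: cong2_left add.commute)
  show "0 + a = a" by transfer simp
  show "- a + a = 0" by transfer (simp add: cong2_refl Zphi_zero)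
  show "a - b = a + - b"
    by transfer (intro cong2_eqI Zphi_diff; simp add: cong2_left)
  show "(a + b) * c = a * c + b * c"
    by transfer (intro cong2_eqI Zphi_add Zphi_mult; simp add: cong2_left distrib_right)
  show "(0::zphi2) \<noteq> 1"
    by transfer (use cong2_iff[of 0 0 1 0] in simp)
  show "a \<noteq> 0 \<Longrightarrow> inverse a * a = 1"
    unfolding inverse_zphi2_def by transfer (intro cong2_cube cong2_left)
  show "inverse (0::zphi2) = 0"
    unfolding inverse_zphi2_def by transfer (simp add: cong2_refl Zphi_zero)
  show "a div b = a * inverse b" by (rule divide_zphi2_def)
qed

end

lemma red2_eq_iff: "x \<in> \<int>[\<phi>] \<Longrightarrow> y \<in> \<int>[\<phi>] \<Longrightarrow> red2 x = red2 y \<longleftrightarrow> (\<exists>z \<in> \<int>[\<phi>]. x - y = 2 * z)"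
  using Quotient3_rel[OF Quotient3_zphi2, of x y] cong2_refl[of x] cong2_refl[of y]
  by (simp add: cong2_def)

lemma red2_surj: "\<exists>x \<in> \<int>[\<phi>]. red2 x = a"
proof
  show "rep_zphi2 a \<in> \<int>[\<phi>]"
    using Quotient3_rep_reflp[OF Quotient3_zphi2] by (rule cong2_left)
  show "red2 (rep_zphi2 a) = a"
    by (rule Quotient3_abs_rep[OF Quotient3_zphi2])
qed

lemma red2_add: "x \<in> \<int>[\<phi>] \<Longrightarrow> y \<in> \<int>[\<phi>] \<Longrightarrow> red2 (x + y) = red2 x + red2 y"
  by (simp add: plus_zphi2.abs_eq cong2_refl)

lemma red2_mult: "x \<in> \<int>[\<phi>] \<Longrightarrow> y \<in> \<int>[\<phi>] \<Longrightarrow> red2 (x * y) = red2 x * red2 y"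
  by (simp add: times_zphi2.abs_eq cong2_refl)

text \<open>\<open>Quat a b c d\<close> stands for \<open>a + b i + c j + d k\<close>.\<close>
datatype 'a quat = Quat (qre: 'a) (qi: 'a) (qj: 'a) (qk: 'a)

instantiation quat :: (comm_ring_1) ring_1
begin

definition "0 = Quat 0 0 0 0"
definition "1 = Quat 1 0 0 0"
definition "x + y = Quat (qre x + qre y) (qi x + qi y) (qj x + qj y) (qk x + qk y)"
definition "- x = Quat (- qre x) (- qi x) (- qj x) (- qk x)"
definition "x - y = Quat (qre x - qre y) (qi x - qi y) (qj x - qj y) (qk x - qk y)"
definition "x * y = Quat
  (qre x * qre y - qi x * qi y - qj x * qj y - qk x * qk y)
  (qre x * qi y + qi x * qre y + qj x * qk y - qk x * qj y)
  (qre x * qj y - qi x * qk y + qj x * qre y + qk x * qi y)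
  (qre x * qk y + qi x * qj y - qj x * qi y + qk x * qre y)"

lemmas quat_ops = zero_quat_def one_quat_def plus_quat_def uminus_quat_def minus_quat_def times_quat_def

instance
  by standard (simp_all add: quat_ops algebra_simps quat.expand)

end

definition quat_i :: "'a::comm_ring_1 quat" where "quat_i = Quat 0 1 0 0"
definition quat_j :: "'a::comm_ring_1 quat" where "quat_j = Quat 0 0 1 0"
definition quat_k :: "'a::comm_ring_1 quat" where "quat_k = Quat 0 0 0 1"

lemma quat_units:
  "quat_i * quat_i = - 1" "quat_j * quat_j = - 1" "quat_k * quat_k = - 1" "quat_i * quat_j * quat_k = - 1"
  by (simp_all add: quat_i_def quat_j_def quat_k_def quat_ops)

definition qscale :: "'a::comm_ring_1 \<Rightarrow> 'a quat \<Rightarrow> 'a quat" (infixr \<open>*\<^sub>H\<close> 75) where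
  "c *\<^sub>H x = Quat (c * qre x) (c * qi x) (c * qj x) (c * qk x)"

definition qconj :: "'a::comm_ring_1 quat \<Rightarrow> 'a quat" where
  "qconj x = Quat (qre x) (- qi x) (- qj x) (- qk x)"

text \<open>\<open>Oct a b\<close> stands for \<open>a + b\<ell>\<close>. The product is not associative.\<close>
datatype 'a oct = Oct (fstH: "'a quat") (sndH: "'a quat")

instantiation oct :: (comm_ring_1) "{ab_group_add, times}"
begin

definition "0 = Oct 0 0"
definition "x + y = Oct (fstH x + fstH y) (sndH x + sndH y)"
definition "- x = Oct (- fstH x) (- sndH x)"
definition "x - y = Oct (fstH x - fstH y) (sndH x - sndH y)"
definition "x * y = Oct
  (fstH x * fstH y - qconj (sndH y) * sndH x)
  (sndH y * fstH x + sndH x * qconj (fstH y))"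

lemmas oct_ops = zero_oct_def plus_oct_def uminus_oct_def minus_oct_def times_oct_def

instance
  by standard (simp_all add: oct_ops algebra_simps oct.expand)

end

definition oscale :: "'a::comm_ring_1 \<Rightarrow> 'a oct \<Rightarrow> 'a oct" (infixr \<open>*\<^sub>O\<close> 75) where
  "c *\<^sub>O x = Oct (c *\<^sub>H fstH x) (c *\<^sub>H sndH x)"

definition oconj :: "'a::comm_ring_1 oct \<Rightarrow> 'a oct" where
  "oconj x = Oct (qconj (fstH x)) (- sndH x)"

text \<open>The product \<open>x * oconj x\<close> is a scalar; \<open>octnorm\<close> is that scalar, as an element of the base ring.\<close>
definition octnorm :: "'a::comm_ring_1 oct \<Rightarrow> 'a" where
  "octnorm x = qre (fstH (x * oconj x))"

lemma mult_oconj: "x * oconj x = octnorm x *\<^sub>O Oct 1 0"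
  by (simp add: octnorm_def oscale_def qscale_def oconj_def qconj_def quat_ops oct_ops algebra_simps)

definition polarB :: "'a::comm_ring_1 oct \<Rightarrow> 'a oct \<Rightarrow> 'a" where
  "polarB x y = octnorm (x + y) - octnorm x - octnorm y"

definition icos_e :: "4 \<Rightarrow> qsqrt5 quat" where
  "icos_e r = (vector
     [1,
      quat_i,
      (1/2) *\<^sub>H (1 + quat_i + quat_j + quat_k),
      (1/2) *\<^sub>H (- 1 + (\<phi> - 1) *\<^sub>H quat_i - \<phi> *\<^sub>H quat_j)] :: qsqrt5 quat ^ 4) $ r"

definition icosians :: "qsqrt5 quat set" (\<open>\<I>\<close>) where
  "\<I> = {\<Sum>r\<in>UNIV. c r *\<^sub>H icos_e r | c. \<forall>r. c r \<in> \<int>[\<phi>]}"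

definition G0 :: "qsqrt5 oct set" where
  "G0 = {Oct a b | a b. a \<in> \<I> \<and> b \<in> \<I>}"

text \<open>The eight coordinates are indexed by the sum type \<open>4 + 4\<close>, so that \<open>Inl r\<close> belongs to \<open>e\<^sub>r\<close>
  and \<open>Inr r\<close> to \<open>e\<^sub>r\<ell>\<close>.\<close>
definition G0_basis :: "4 + 4 \<Rightarrow> qsqrt5 oct" where
  "G0_basis s = (case s of Inl r \<Rightarrow> Oct (icos_e r) 0 | Inr r \<Rightarrow> Oct 0 (icos_e r))"

definition lincomb :: "qsqrt5 ^ (4 + 4) \<Rightarrow> qsqrt5 oct" where
  "lincomb c = (\<Sum>s\<in>UNIV. c $ s *\<^sub>O G0_basis s)"

text \<open>\<open>v = lincomb c\<close> runs over \<open>G0\<close>, and \<open>v mod 2 G0\<close> is identified with the vector of the residues of its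
  coordinates.\<close>
definition G_enl :: "(zphi2 ^ (4 + 4)) set \<Rightarrow> qsqrt5 oct set" where
  "G_enl C = {(1/2) *\<^sub>O lincomb c | c. (\<forall>s. c $ s \<in> \<int>[\<phi>]) \<and> (\<chi> s. red2 (c $ s)) \<in> C}"

text \<open>A coset \<open>x + G0\<close> lies in the first (second) half if it has a representative in
  \<open>(1/2)\<I>\<close> (in \<open>(1/2)\<I>\<ell>\<close>).\<close>
definition mixed_coset :: "qsqrt5 oct set \<Rightarrow> bool" where
  "mixed_coset G \<longleftrightarrow>
     \<not> (\<forall>x\<in>G. \<exists>a\<in>\<I>. x - Oct ((1/2) *\<^sub>H a) 0 \<in> G0) \<and>
     \<not> (\<forall>x\<in>G. \<exists>b\<in>\<I>. x - Oct 0 ((1/2) *\<^sub>H b) \<in> G0)"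

definition integral_pairing :: "qsqrt5 oct set \<Rightarrow> bool" where
  "integral_pairing G \<longleftrightarrow> (\<forall>x\<in>G. \<forall>s. polarB x (G0_basis s) \<in> \<int>[\<phi>])"

definition integral_norm :: "qsqrt5 oct set \<Rightarrow> bool" where
  "integral_norm G \<longleftrightarrow> (\<forall>x\<in>G. octnorm x \<in> \<int>[\<phi>])"

definition G3_candidate :: "qsqrt5 oct set \<Rightarrow> bool" where
  "G3_candidate G \<longleftrightarrow>
     (\<exists>C. vec.subspace C \<and> G = G_enl C) \<and>
     mixed_coset G \<and>
     (\<forall>x\<in>G. oconj x \<in> G) \<and>
     integral_pairing G \<and>
     integral_norm G \<and>
     (\<forall>x\<in>G. \<forall>y\<in>G. x * y \<in> G) \<and>
     (\<forall>x\<in>G. x * x \<in> G)"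

end

theory Submission
  imports Defs
begin

text \<open>The pairing \<open>B\<close> on \<open>G\<^sub>0\<close> is unimodular over \<open>\<int>[\<phi>]\<close>: it splits into two copies of the pairing of
  the icosians, whose Gram matrix in the basis \<open>e\<^sub>1, \<dots>, e\<^sub>4\<close> has determinant \<open>\<phi>\<^sup>2\<close>, a unit. So \<open>G\<^sub>0\<close> is its own
  dual lattice, and integral pairings with its basis force an enlargement to equal \<open>G\<^sub>0\<close>.\<close>

lemma golden_in_Zphi: "\<phi> \<in> \<int>[\<phi>]"
  unfolding Zphi_def by (rule CollectI, rule exI[of _ 0], rule exI[of _ 1]) simp

lemma polarB_eq:
  "polarB x y = 2 *
     (qre (fstH x) * qre (fstH y) + qi (fstH x) * qi (fstH y)
      + qj (fstH x) * qj (fstH y) + qk (fstH x) * qk (fstH y)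
      + qre (sndH x) * qre (sndH y) + qi (sndH x) * qi (sndH y)
      + qj (sndH x) * qj (sndH y) + qk (sndH x) * qk (sndH y))"
  by (simp add: polarB_def octnorm_def oconj_def qconj_def quat_ops oct_ops algebra_simps)

lemma icos_e_simps:
  "icos_e 1 = Quat 1 0 0 0"
  "icos_e 2 = Quat 0 1 0 0"
  "icos_e 3 = Quat (1/2) (1/2) (1/2) (1/2)"
  "icos_e 4 = Quat (- 1/2) ((\<phi> - 1)/2) (- \<phi>/2) 0"
  by (simp_all add: icos_e_def vector_def qscale_def quat_ops quat_i_def quat_j_def quat_k_def)

lemma sum_sum_type_4:
  "(\<Sum>s\<in>UNIV. f s) = f (Inl 1) + f (Inl 2) + f (Inl 3) + f (Inl 4)
     + f (Inr 1) + f (Inr 2) + f (Inr 3) + f (Inr (4::4))"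
  for f :: "4 + 4 \<Rightarrow> 'a::comm_monoid_add"
proof -
  have "(\<Sum>s\<in>UNIV. f s) = (\<Sum>r\<in>UNIV. f (Inl r)) + (\<Sum>r\<in>UNIV. f (Inr r))"
    using sum.Plus[of "UNIV :: 4 set" "UNIV :: 4 set" f] by simp
  then show ?thesis by (simp add: sum_4 add.assoc)
qed

text \<open>The sum of all \<open>y r *\<^sub>H icos_e r\<close>, written out in the basis 1, i, j,
  k.\<close>

definition icos_comb :: "(4 \<Rightarrow> qsqrt5) \<Rightarrow> qsqrt5 quat" where
  "icos_comb y = Quat (y 1 + y 3 / 2 - y 4 / 2) (y 2 + y 3 / 2 + (\<phi> - 1) * y 4 / 2)
     (y 3 / 2 - \<phi> * y 4 / 2) (y 3 / 2)"

lemma lincomb_eq: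
  "lincomb c = Oct (icos_comb (\<lambda>r. c $ Inl r)) (icos_comb (\<lambda>r. c $ Inr r))"
  unfolding lincomb_def sum_sum_type_4
  by (simp add: G0_basis_def icos_e_simps icos_comb_def oscale_def qscale_def oct_ops quat_ops algebra_simps)

lemma oscale_lincomb: "a *\<^sub>O lincomb c = lincomb (a *s c)"
  by (simp add: lincomb_eq icos_comb_def oscale_def qscale_def algebra_simps)

text \<open>The formulas for the \<open>y\<^sub>i\<close> in terms of the pairings \<open>p\<^sub>i\<close> invert the Gram matrix; \<open>t = 1/\<phi>\<close>, and \<open>u\<close> is
  twice the \<open>j\<close>-coordinate of the combination.\<close>
lemma icosian_gram_inverse:
  fixes y1 y2 y3 y4 :: qsqrt5
  assumes "2 * y1 + y3 - y4 \<in> \<int>[\<phi>]" "2 * y2 + y3 + (\<phi> - 1) * y4 \<in> \<int>[\<phi>]"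
    "y1 + y2 + 2 * y3 - y4 \<in> \<int>[\<phi>]" "- y1 + (\<phi> - 1) * y2 - y3 + 2 * y4 \<in> \<int>[\<phi>]"
  shows "y1 \<in> \<int>[\<phi>] \<and> y2 \<in> \<int>[\<phi>] \<and> y3 \<in> \<int>[\<phi>] \<and> y4 \<in> \<int>[\<phi>]"
proof -
  define t where "t = \<phi> - 1"
  define p1 where "p1 = 2 * y1 + y3 - y4"
  define p2 where "p2 = 2 * y2 + y3 + t * y4"
  define p3 where "p3 = y1 + y2 + 2 * y3 - y4"
  define p4 where "p4 = - y1 + t * y2 - y3 + 2 * y4"
  \<comment> \<open>Since 2 e4 = -e1 + t e2 - \<phi> j, the bracket is \<phi> times the pairing with
    j; the factor \<open>t\<close> = 1/\<phi> leaves that pairing.\<close>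
  define u where "u = t * (t * p2 - 2 * p4 - p1)"
  note p_defs = p1_def p2_def p3_def p4_def
  have two: "2 \<in> \<int>[\<phi>]"
    using Zphi_add[OF Zphi_one Zphi_one] by simp
  have t: "t \<in> \<int>[\<phi>]" and p: "p1 \<in> \<int>[\<phi>]" "p2 \<in> \<int>[\<phi>]" "p3 \<in> \<int>[\<phi>]" "p4 \<in> \<int>[\<phi>]"
    using assms by (simp_all add: t_def p_defs Zphi_diff golden_in_Zphi Zphi_one)
  have u: "u \<in> \<int>[\<phi>]"
    unfolding u_def by (intro Zphi_mult Zphi_diff t p two)
  have tt: "t * t = 1 - t"
    using golden_squared by (simp add: t_def algebra_simps)
  have u_eq: "u = y3 - (1 + t) * y4"
    using tt unfolding u_def p_defs by algebra
  \<comment> \<open>From 2 e3 = 1 + i + j + k, because the pairing with k is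
    \<open>y3\<close>.\<close>
  have y3: "y3 = 2 * p3 - p1 - p2 - u"
    unfolding u_eq p_defs by algebra
  have y4: "y4 = t * (y3 - u)"
    using tt unfolding u_eq by algebra
  \<comment> \<open>Solving \<open>p1\<close> for \<open>y1\<close> would require halving. Instead,
    \<open>t * p3 - p4\<close> is free of \<open>y2\<close> and has the unit 1 + t = \<phi> as
    coefficient of \<open>y1\<close>; \<open>p3 + p4\<close> does the same for
    \<open>y2\<close>.\<close>
  have y1: "y1 = p1 - p3 + t * p3 - t * u + (1 - t) * p2 - t * p1 - t * p4"
    using tt unfolding u_eq p_defs by algebra
  have y2: "y2 = p2 - p3 - (1 - t) * (p3 - u) + (1 - t) * (p1 + p2) - t * p4"
    using tt unfolding u_eq p_defs by algebra
  have "y1 \<in> \<int>[\<phi>]" "y2 \<in> \<int>[\<phi>]"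
    unfolding y1 y2 by (intro Zphi_mult Zphi_add Zphi_diff Zphi_one t p u)+
  moreover have y3_in: "y3 \<in> \<int>[\<phi>]"
    unfolding y3 by (intro Zphi_mult Zphi_diff two p u)
  moreover have "y4 \<in> \<int>[\<phi>]"
    unfolding y4 by (intro Zphi_mult Zphi_diff t y3_in u)
  ultimately show ?thesis by blast
qed

lemma golden_golden_mult: "\<phi> * (\<phi> * x) = \<phi> * x + x"
  by (metis golden_squared distrib_right mult.assoc mult_1)

lemma polarB_icos_comb:
  "polarB (Oct (icos_comb y) b) (Oct (icos_e 1) 0) = 2 * y 1 + y 3 - y 4"
  "polarB (Oct (icos_comb y) b) (Oct (icos_e 2) 0) = 2 * y 2 + y 3 + (\<phi> - 1) * y 4"
  "polarB (Oct (icos_comb y) b) (Oct (icos_e 3) 0) = y 1 + y 2 + 2 * y 3 - y 4"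
  "polarB (Oct (icos_comb y) b) (Oct (icos_e 4) 0) = - y 1 + (\<phi> - 1) * y 2 - y 3 + 2 * y 4"
  by (simp_all add: polarB_eq icos_comb_def icos_e_simps quat_ops field_simps golden_golden_mult)

text \<open>Exchanging the halves is an isometry, so the pairings computed for the first half serve
  for the second.\<close>

lemma polarB_swap: "polarB (Oct a b) (Oct 0 c) = polarB (Oct b a) (Oct c 0)"
  by (simp add: polarB_eq quat_ops)

text \<open>Each half of the basis sees only the coordinates \<open>y\<close> of that half, and
  there the Gram matrix is invertible over \<int>[\<phi>].\<close>

lemma icosian_double_self_dual:
  assumes "\<And>s. polarB (lincomb y) (G0_basis s) \<in> \<int>[\<phi>]"
  shows "y $ s \<in> \<int>[\<phi>]"
proof -
  have "\<forall>r. y $ Inl r \<in> \<int>[\<phi>]"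
    \<comment> \<open>The instances follow the order in which the variables first occur in the
      assumptions: \<open>y1\<close>, \<open>y3\<close>, \<open>y4\<close>,
      \<open>y2\<close>.\<close>
    using icosian_gram_inverse[of "y $ Inl 1" "y $ Inl 3" "y $ Inl 4" "y $ Inl 2"]
      assms[of "Inl 1"] assms[of "Inl 2"] assms[of "Inl 3"] assms[of "Inl 4"]
    unfolding forall_4 lincomb_eq G0_basis_def sum.case polarB_icos_comb by blast
  moreover have "\<forall>r. y $ Inr r \<in> \<int>[\<phi>]"
    using icosian_gram_inverse[of "y $ Inr 1" "y $ Inr 3" "y $ Inr 4" "y $ Inr 2"]
      assms[of "Inr 1"] assms[of "Inr 2"] assms[of "Inr 3"] assms[of "Inr 4"]
    unfolding forall_4 lincomb_eq G0_basis_def sum.case polarB_swap polarB_icos_comb by blast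
  ultimately show ?thesis by (cases s) auto
qed

text \<open>Lift \<open>v\<close> to integral coordinates \<open>c\<close>. Half of the lift lies in
  the enlargement, so by self-duality \<open>c\<close> is divisible by 2 and its residue
  \<open>v\<close> vanishes.\<close>

lemma integral_pairing_imp_trivial:
  assumes "integral_pairing (G_enl C)" "v \<in> C"
  shows "v = 0"
proof -
  have "\<exists>x. x \<in> \<int>[\<phi>] \<and> red2 x = v $ s" for s
    using red2_surj by blast
  then obtain f where f: "\<And>s. f s \<in> \<int>[\<phi>]" "\<And>s. red2 (f s) = v $ s"
    by metis
  define c where "c = (\<chi> s. f s)"
  have c: "c $ s \<in> \<int>[\<phi>]" "red2 (c $ s) = v $ s" for s
    by (simp_all add: c_def f)
  have "(\<chi> s. red2 (c $ s)) = v"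
    by (simp add: vec_eq_iff c)
  then have "(1/2) *\<^sub>O lincomb c \<in> G_enl C"
    unfolding G_enl_def using c assms(2) by blast
  then have half: "((1/2) *s c) $ s \<in> \<int>[\<phi>]" for s
    using assms(1) icosian_double_self_dual
    unfolding integral_pairing_def oscale_lincomb by blast
  have "v $ s = 0" for s
  proof -
    have "c $ s - 0 = 2 * ((1/2) *s c) $ s" by simp
    then have "red2 (c $ s) = red2 0"
      using half c(1) red2_eq_iff Zphi_zero by blast
    then show ?thesis by (simp add: c zero_zphi2_def)
  qed
  then show ?thesis by (simp add: vec_eq_iff)
qed

theorem proposition6p11:
  fixes C :: "(zphi2 ^ (4 + 4)) set"
  assumes "vec.subspace C"
    and "C \<noteq> {0}"
  shows "\<not> G3_candidate (G_enl C)"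
proof
  assume "G3_candidate (G_enl C)"
  then have "integral_pairing (G_enl C)"
    by (simp add: G3_candidate_def)
  then have "C \<subseteq> {0}"
    using integral_pairing_imp_trivial by blast
  then show False
    using assms vec.subspace_0 by blast
qed

end
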